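(* Let $Y$ and $Y_n$ ($n\ge 0$) be square-integrable real random variables on a common probability space with $\|Y_n-Y\|\to 0$ as $n\to\infty$, and set $Y_{-1}=0$. Let $(\tilde\Delta_n:n\ge0)$ be a sequence of independent random variables such that, for each $n\ge0$, $\tilde\Delta_n$ has the same distribution as $Y_n-Y_{n-1}$. Let $q=(q_i)_{i\ge0}\in A$, and let $N$ be a nonnegative-integer-valued random variable, independent of $(\tilde\Delta_i:i\ge0)$, such that $\Pr(N\ge i)=q_i$ for all $i\ge0$. Define $$\tilde Z=\sum_{i=0}^{N}\frac{\tilde\Delta_i}{q_i}.$$ Then $\tilde Z$ is square-integrable if and only if $$\sum_{i=0}^{\infty}\left(\frac{\mathrm{Var}(Y_i-Y_{i-1})}{q_i}+\Big(\frac1{q_{i+1}}-\frac1{q_i}\Big)\big(E(Y_i-Y)\big)^2\right)<\infty .$$ Furthermore, if this series is finite, then $E(\tilde Z)=E(Y)$ and $$\|\tilde Z\|^2=(E(Y))^2+\sum_{i=0}^{\infty}\left(\frac{\mathrm{Var}(Y_i-Y_{i-1})}{q_i}+\Big(\frac1{q_{i+1}}-\frac1{q_i}\Big)\big(E(Y_i-Y)\big)^2\right).$$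
   Context: For a square-integrable random variable $X$, $\|X\|=\sqrt{E(X^2)}$. The set $A$ consists of all real sequences $(q_i:i\ge0)$ such that $q_0=1$, $q_i\ge q_{i+1}>0$ for all $i\ge0$, and $\lim_{i\to\infty}q_i=0$. The variable $\tilde Z$ is called the independent sum estimator. *)

theory Defs
  imports "HOL-Probability.Probability"
begin

definition square_integrable :: "'a measure \<Rightarrow> ('a \<Rightarrow> real) \<Rightarrow> bool" where
  "square_integrable M X \<longleftrightarrow> X \<in> borel_measurable M \<and> integrable M (\<lambda>\<omega>. (X \<omega>)\<^sup>2)"

text \<open>The value is meaningful only for square-integrable arguments, because the Bochner integral of
  a non-integrable function is \<open>0\<close>.\<close>
definition L2_norm :: "'a measure \<Rightarrow> ('a \<Rightarrow> real) \<Rightarrow> real" where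
  "L2_norm M X = sqrt (prob_space.expectation M (\<lambda>\<omega>. (X \<omega>)\<^sup>2))"

text \<open>The set \<open>A\<close> of admissible tail sequences.\<close>
definition tail_sequences :: "(nat \<Rightarrow> real) set" where
  "tail_sequences =
     {q. q 0 = 1 \<and> (\<forall>i. q i \<ge> q (Suc i) \<and> q (Suc i) > 0) \<and> q \<longlonglongrightarrow> 0}"

text \<open>\<open>Y\<^sub>n - Y\<^sub>n\<^sub>-\<^sub>1\<close>, with the convention \<open>Y\<^sub>-\<^sub>1 = 0\<close>.\<close>
definition increment :: "(nat \<Rightarrow> 'a \<Rightarrow> real) \<Rightarrow> nat \<Rightarrow> 'a \<Rightarrow> real" where
  "increment Y n = (\<lambda>\<omega>. Y n \<omega> - (case n of 0 \<Rightarrow> 0 | Suc m \<Rightarrow> Y m \<omega>))"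

text \<open>The library's \<open>prob_space.indep_var\<close> forces both random variables to take values in the same
  type. This is the version for different value types: the generated sigma-algebras are
  independent.\<close>
definition indep_rvs ::
  "'a measure \<Rightarrow> 'b measure \<Rightarrow> ('a \<Rightarrow> 'b) \<Rightarrow> 'c measure \<Rightarrow> ('a \<Rightarrow> 'c) \<Rightarrow> bool" where
  "indep_rvs M S X T Z \<longleftrightarrow>
     X \<in> measurable M S \<and> Z \<in> measurable M T \<and>
     prob_space.indep_set M {X -` A \<inter> space M | A. A \<in> sets S} {Z -` B \<inter> space M | B. B \<in> sets T}"

definition independent_sum_estimator ::
  "(nat \<Rightarrow> real) \<Rightarrow> (nat \<Rightarrow> 'a \<Rightarrow> real) \<Rightarrow> ('a \<Rightarrow> nat) \<Rightarrow> 'a \<Rightarrow> real" where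
  "independent_sum_estimator q D N = (\<lambda>\<omega>. \<Sum>i=0..N \<omega>. D i \<omega> / q i)"

definition variance_series_term ::
  "'a measure \<Rightarrow> (nat \<Rightarrow> 'a \<Rightarrow> real) \<Rightarrow> ('a \<Rightarrow> real) \<Rightarrow> (nat \<Rightarrow> real) \<Rightarrow> nat \<Rightarrow> real" where
  "variance_series_term M Yn Y q i =
     prob_space.variance M (increment Yn i) / q i
     + (1 / q (Suc i) - 1 / q i) * (prob_space.expectation M (\<lambda>\<omega>. Yn i \<omega> - Y \<omega>))\<^sup>2"

end

theory Submission
  imports Defs
begin

text \<open>Conditioning on \<open>N\<close> gives \<open>E(Z\<^sup>2) = (\<Sum>n. p\<^sub>n * (U\<^sub>n + m\<^sub>n\<^sup>2))\<close>, where \<open>p\<^sub>n = q\<^sub>n - q\<^sub>n\<^sub>+\<^sub>1\<close> and \<open>U\<^sub>n\<close>, \<open>m\<^sub>n\<close> are the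
  variance and the mean of the partial sum \<open>\<Sum>i\<le>n. D\<^sub>i / q\<^sub>i\<close>. Exchanging the order of summation turns
  \<open>\<Sum>n. p\<^sub>n * U\<^sub>n\<close> into \<open>\<Sum>i. v\<^sub>i / q\<^sub>i\<close>. With \<open>e\<^sub>i = E(Y\<^sub>i - Y)\<close> and \<open>c\<^sub>i = 1 / q\<^sub>i\<^sub>+\<^sub>1 - 1 / q\<^sub>i\<close>, Abel summation
  gives \<open>m\<^sub>n = e\<^sub>n / q\<^sub>n + B\<^sub>n\<close> for \<open>B\<^sub>n = E(Y) - (\<Sum>i<n. c\<^sub>i * e\<^sub>i)\<close>, and
  \<open>\<Sum>n<K. p\<^sub>n * m\<^sub>n\<^sup>2\<close> differs from \<open>E(Y)\<^sup>2 + (\<Sum>n<K. c\<^sub>n * e\<^sub>n\<^sup>2)\<close> by exactly \<open>q\<^sub>K * B\<^sub>K\<^sup>2\<close>. This error tends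
  to \<open>0\<close> when the series of the \<open>c\<^sub>n * e\<^sub>n\<^sup>2\<close> converges, and it is bounded when that of the
  \<open>p\<^sub>n * m\<^sub>n\<^sup>2\<close> converges.\<close>

subsection \<open>Summation by parts against a tail sequence\<close>

lemma tail_sequencesD:
  assumes "q \<in> tail_sequences"
  shows "q 0 = 1" "q i > 0" "q (Suc i) \<le> q i" "decseq q" "q \<longlonglongrightarrow> 0"
proof -
  show "q 0 = 1" "q (Suc i) \<le> q i" "q \<longlonglongrightarrow> 0" "decseq q"
    using assms by (auto simp: tail_sequences_def intro: decseq_SucI)
  show "q i > 0"
    using assms by (cases i) (auto simp: tail_sequences_def)
qed

text \<open>Abel summation by induction: a new increment over \<open>q (Suc n)\<close> is the change
  of \<open>e n / q n\<close> minus the change of \<open>1 / q\<close> times the old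
  \<open>e n\<close>. The constant \<open>a\<close> sits in the first summand only, because the
  convention that \<open>Y\<close> vanishes at index -1 makes the first mean increment
  \<open>e 0 + a\<close>.\<close>

lemma sum_increment_div:
  fixes q e :: "nat \<Rightarrow> real"
  assumes "\<And>n. q n \<noteq> 0"
  shows "(e 0 + a) / q 0 + (\<Sum>i<n. (e (Suc i) - e i) / q (Suc i)) =
    e n / q n + (a / q 0 - (\<Sum>i<n. (1 / q (Suc i) - 1 / q i) * e i))"
proof (induction n)
  case (Suc n)
  have "(e (Suc n) - e n) / q (Suc n) =
      e (Suc n) / q (Suc n) - e n / q n - (1 / q (Suc n) - 1 / q n) * e n"
    using assms[of n] assms[of "Suc n"] by (simp add: field_simps)
  with Suc show ?case by simp
qed (simp add: add_divide_distrib)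

text \<open>The recursion for \<open>B\<close> turns each summand into
  \<open>q n * B n - q (Suc n) * B (Suc n)\<close>, so the sum telescopes.\<close>

lemma sum_tail_weighted:
  fixes q e B :: "nat \<Rightarrow> real"
  assumes q: "\<And>n. q n \<noteq> 0"
    and B: "\<And>n. B (Suc n) = B n - (1 / q (Suc n) - 1 / q n) * e n"
  shows "(\<Sum>n<K. (q n - q (Suc n)) * (e n / q n + B n)) = q 0 * B 0 - q K * B K"
proof -
  have "(q n - q (Suc n)) * (e n / q n + B n) = q n * B n - q (Suc n) * B (Suc n)" for n
    using q[of n] q[of "Suc n"] by (simp add: B field_simps)
  then show ?thesis
    by (induction K) simp_all
qed

text \<open>The summands differ by the telescoping quantity \<open>q n * (B n)\<^sup>2\<close>.\<close>
lemma sum_tail_weighted_square: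
  fixes q e B :: "nat \<Rightarrow> real"
  assumes q: "\<And>n. q n \<noteq> 0"
    and B: "\<And>n. B (Suc n) = B n - (1 / q (Suc n) - 1 / q n) * e n"
  shows "(\<Sum>n<K. (q n - q (Suc n)) * (e n / q n + B n)\<^sup>2) =
    q 0 * (B 0)\<^sup>2 - q K * (B K)\<^sup>2 + (\<Sum>n<K. (1 / q (Suc n) - 1 / q n) * (e n)\<^sup>2)"
proof -
  have "(q n - q (Suc n)) * (e n / q n + B n)\<^sup>2 =
      q n * (B n)\<^sup>2 - q (Suc n) * (B (Suc n))\<^sup>2 + (1 / q (Suc n) - 1 / q n) * (e n)\<^sup>2" for n
    using q[of n] q[of "Suc n"] by (simp add: B field_simps power2_eq_square)
  then show ?thesis
    by (induction K) simp_all
qed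

section \<open>Averages with the increments of \<open>1 / q\<close> as weights\<close>

context
  fixes q :: "nat \<Rightarrow> real"
  assumes q: "q \<in> tail_sequences"
begin

private abbreviation c :: "nat \<Rightarrow> real" where
  "c i \<equiv> 1 / q (Suc i) - 1 / q i"

lemma inverse_tail_diff_nonneg: "c i \<ge> 0"
  using tail_sequencesD(2,3)[OF q] by (simp add: frac_le)

text \<open>The \<open>c i\<close> telescope, leaving \<open>1 - q K / q J\<close>. Hence the
  weights \<open>q K * c i\<close> have total mass at most 1, which drives both limit lemmas
  below.\<close>

lemma tail_mult_sum_inverse_diff_le: "q K * (\<Sum>i\<in>{J..<K}. c i) \<le> 1"
proof (cases "J \<le> K")
  case True
  have "(\<Sum>i\<in>{J..<K}. c i) = 1 / q K - 1 / q J"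
    using sum_Suc_diff'[OF True, of "\<lambda>i. 1 / q i"] by simp
  then have "q K * (\<Sum>i\<in>{J..<K}. c i) = 1 - q K / q J"
    using tail_sequencesD(2)[OF q, of K] by (simp add: right_diff_distrib)
  then show ?thesis
    using tail_sequencesD(2)[OF q] by (simp add: less_imp_le)
qed simp

text \<open>A Toeplitz argument: the block before a fixed \<open>J\<close> is killed by
  \<open>q K\<close>, and beyond \<open>J\<close> small values of \<open>e\<close> are averaged with
  total weight at most 1.\<close>

lemma tendsto_tail_weighted_mean:
  assumes e: "e \<longlonglongrightarrow> 0"
  shows "(\<lambda>K. q K * (\<Sum>i<K. c i * e i)) \<longlonglongrightarrow> 0"
proof (rule LIMSEQ_I)
  fix r :: real assume "r > 0"
  then obtain J where J: "\<And>i. i \<ge> J \<Longrightarrow> \<bar>e i\<bar> < r / 2"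
    using LIMSEQ_D[OF e, of "r/2"] by auto
  have "(\<lambda>K. q K * (\<Sum>i<J. c i * e i)) \<longlonglongrightarrow> 0"
    using tendsto_mult_right[OF tail_sequencesD(5)[OF q], of "\<Sum>i<J. c i * e i"] by simp
  then obtain L where L: "\<And>K. K \<ge> L \<Longrightarrow> \<bar>q K * (\<Sum>i<J. c i * e i)\<bar> < r / 2"
    using LIMSEQ_D[of _ 0 "r/2"] \<open>r > 0\<close> by force
  have "\<bar>q K * (\<Sum>i<K. c i * e i)\<bar> < r" if K: "K \<ge> max J L" for K
  proof -
    have "\<bar>\<Sum>i\<in>{J..<K}. c i * e i\<bar> \<le> (\<Sum>i\<in>{J..<K}. c i * (r / 2))"
    proof (intro order_trans[OF sum_abs] sum_mono)
      fix i assume "i \<in> {J..<K}"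
      then show "\<bar>c i * e i\<bar> \<le> c i * (r / 2)"
        using mult_left_mono[OF less_imp_le[OF J[of i]] inverse_tail_diff_nonneg[of i]]
          inverse_tail_diff_nonneg[of i] by (simp add: abs_mult)
    qed
    also have "\<dots> = (\<Sum>i\<in>{J..<K}. c i) * (r / 2)"
      by (simp add: sum_distrib_right)
    finally have "q K * \<bar>\<Sum>i\<in>{J..<K}. c i * e i\<bar> \<le> (q K * (\<Sum>i\<in>{J..<K}. c i)) * (r / 2)"
      using tail_sequencesD(2)[OF q, of K] by (simp add: mult.assoc mult_left_mono)
    also have "\<dots> \<le> r / 2"
      using mult_right_mono[OF tail_mult_sum_inverse_diff_le[of K J], of "r/2"] \<open>r > 0\<close> by simp
    finally have tail: "\<bar>q K * (\<Sum>i\<in>{J..<K}. c i * e i)\<bar> \<le> r / 2"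
      using tail_sequencesD(2)[OF q, of K] by (simp add: abs_mult)
    have "(\<Sum>i<K. c i * e i) = (\<Sum>i<J. c i * e i) + (\<Sum>i\<in>{J..<K}. c i * e i)"
      using K by (simp add: sum.atLeastLessThan_concat lessThan_atLeast0)
    then show ?thesis
      using tail L[of K] K by (simp add: distrib_left)
  qed
  then show "\<exists>no. \<forall>K\<ge>no. norm (q K * (\<Sum>i<K. c i * e i) - 0) < r"
    unfolding real_norm_def diff_0_right by blast
qed

text \<open>The same splitting at \<open>J\<close>; the block beyond \<open>J\<close> is now
  controlled by Cauchy-Schwarz and the Cauchy criterion for the assumed series, with no limit of
  \<open>e\<close> involved.\<close>

lemma tendsto_tail_weighted_square:
  assumes e: "summable (\<lambda>i. c i * (e i)\<^sup>2)"
  shows "(\<lambda>K. q K * (\<Sum>i<K. c i * e i)\<^sup>2) \<longlonglongrightarrow> 0"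
proof (rule LIMSEQ_I)
  fix r :: real assume "r > 0"
  \<comment> \<open>The quarter pays for the factor 2 in
    \<open>(x + y)^2 \<le> 2 * x^2 + 2 * y^2\<close>, applied to the two blocks.\<close>
  then obtain J where "\<forall>m\<ge>J. \<forall>n. norm (\<Sum>i\<in>{m..<n}. c i * (e i)\<^sup>2) < r / 4"
    using e[unfolded summable_Cauchy, rule_format, of "r/4"] by auto
  then have J: "(\<Sum>i\<in>{J..<K}. c i * (e i)\<^sup>2) < r / 4" for K
    by (metis abs_less_iff order_refl real_norm_def)
  have "(\<lambda>K. q K * (\<Sum>i<J. c i * e i)\<^sup>2) \<longlonglongrightarrow> 0"
    using tendsto_mult_right[OF tail_sequencesD(5)[OF q], of "(\<Sum>i<J. c i * e i)\<^sup>2"] by simp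
  then obtain L where L: "\<And>K. K \<ge> L \<Longrightarrow> \<bar>q K * (\<Sum>i<J. c i * e i)\<^sup>2\<bar> < r / 4"
    using LIMSEQ_D[of _ 0 "r/4"] \<open>r > 0\<close> by force
  have "\<bar>q K * (\<Sum>i<K. c i * e i)\<^sup>2\<bar> < r" if K: "K \<ge> max J L" for K
  proof -
    let ?x = "\<Sum>i<J. c i * e i" and ?y = "\<Sum>i\<in>{J..<K}. c i * e i"
    have qK: "q K > 0" using tail_sequencesD(2)[OF q] .
    have nonneg: "0 \<le> (\<Sum>i\<in>{J..<K}. c i * (e i)\<^sup>2)"
      using inverse_tail_diff_nonneg by (intro sum_nonneg) auto
    \<comment> \<open>The weight is split as \<open>sqrt (c i) * sqrt (c i)\<close>, so that
      Cauchy-Schwarz leaves one factor of total mass and one of weighted squares.\<close>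
    have "?y\<^sup>2 = (\<Sum>i\<in>{J..<K}. sqrt (c i) * (sqrt (c i) * e i))\<^sup>2"
      using inverse_tail_diff_nonneg by (simp flip: mult.assoc)
    also have "\<dots> \<le> (\<Sum>i\<in>{J..<K}. (sqrt (c i))\<^sup>2) * (\<Sum>i\<in>{J..<K}. (sqrt (c i) * e i)\<^sup>2)"
      by (rule Cauchy_Schwarz_ineq_sum)
    also have "\<dots> = (\<Sum>i\<in>{J..<K}. c i) * (\<Sum>i\<in>{J..<K}. c i * (e i)\<^sup>2)"
      using inverse_tail_diff_nonneg by (simp add: power_mult_distrib)
    finally have "q K * ?y\<^sup>2 \<le> (q K * (\<Sum>i\<in>{J..<K}. c i)) * (\<Sum>i\<in>{J..<K}. c i * (e i)\<^sup>2)"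
      using qK by (simp add: mult.assoc mult_left_mono)
    also have "\<dots> \<le> 1 * (\<Sum>i\<in>{J..<K}. c i * (e i)\<^sup>2)"
      by (intro mult_right_mono tail_mult_sum_inverse_diff_le nonneg)
    finally have tail: "q K * ?y\<^sup>2 < r / 4" using J[of K] by simp
    have "(\<Sum>i<K. c i * e i) = ?x + ?y"
      using K by (simp add: sum.atLeastLessThan_concat lessThan_atLeast0)
    moreover have "(?x + ?y)\<^sup>2 \<le> 2 * ?x\<^sup>2 + 2 * ?y\<^sup>2"
      using sum_squares_bound[of ?x ?y] by (simp add: power2_sum)
    ultimately have "q K * (\<Sum>i<K. c i * e i)\<^sup>2 \<le> q K * (2 * ?x\<^sup>2 + 2 * ?y\<^sup>2)"
      using qK by (simp add: mult_left_mono)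
    also have "\<dots> < r"
      using tail L[of K] K by (simp add: distrib_left)
    finally show ?thesis using qK by simp
  qed
  then show "\<exists>no. \<forall>K\<ge>no. norm (q K * (\<Sum>i<K. c i * e i)\<^sup>2 - 0) < r"
    unfolding real_norm_def diff_0_right by blast
qed

section \<open>Series of the means of the partial sums and of their squares\<close>

context
  fixes e m :: "nat \<Rightarrow> real" and a :: real
  assumes e: "e \<longlonglongrightarrow> 0"
    and m: "\<And>n. m n = e n / q n + (a - (\<Sum>i<n. c i * e i))"
begin

private definition B :: "nat \<Rightarrow> real" where
  "B n = a - (\<Sum>i<n. c i * e i)"

private lemma B_simps: "B 0 = a" "B (Suc n) = B n - c n * e n"
  by (simp_all add: B_def)

private lemma q_neq_0: "q n \<noteq> 0"
  using tail_sequencesD(2)[OF q, of n] by simp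

private lemma sum_pm: "(\<Sum>n<K. (q n - q (Suc n)) * m n) = a - q K * B K"
  using sum_tail_weighted[of q B e K, OF q_neq_0 B_simps(2)] tail_sequencesD(1)[OF q]
  by (simp add: m B_simps(1) flip: B_def)

private lemma sum_pm_square:
  "(\<Sum>n<K. (q n - q (Suc n)) * (m n)\<^sup>2) = a\<^sup>2 - q K * (B K)\<^sup>2 + (\<Sum>n<K. c n * (e n)\<^sup>2)"
  using sum_tail_weighted_square[of q B e K, OF q_neq_0 B_simps(2)] tail_sequencesD(1)[OF q]
  by (simp add: m B_simps(1) flip: B_def)

private lemma tendsto_qB: "(\<lambda>K. q K * B K) \<longlonglongrightarrow> 0"
proof -
  have "(\<lambda>K. q K * a - q K * (\<Sum>i<K. c i * e i)) \<longlonglongrightarrow> 0 * a - 0"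
    by (intro tendsto_intros tendsto_tail_weighted_mean tail_sequencesD(5)[OF q] e)
  then show ?thesis by (simp add: B_def right_diff_distrib)
qed

text \<open>The error \<open>q K * B K\<close> vanishes as soon as \<open>e\<close> tends to 0,
  without any summability. This will identify the mean of the estimator.\<close>

lemma tail_mean_sums: "(\<lambda>n. (q n - q (Suc n)) * m n) sums a"
  using tendsto_diff[OF tendsto_const[of a] tendsto_qB] by (simp add: sums_def sum_pm)

text \<open>The partial sums are off by \<open>q K * (B K)^2\<close> only, which is squeezed to 0 by
  separating \<open>a\<close> from the weighted sum inside \<open>B K\<close>.\<close>

lemma tail_mean_square_sums:
  assumes "summable (\<lambda>i. c i * (e i)\<^sup>2)"
  shows "(\<lambda>n. (q n - q (Suc n)) * (m n)\<^sup>2) sums (a\<^sup>2 + (\<Sum>i. c i * (e i)\<^sup>2))"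
proof -
  have lim: "(\<lambda>K. 2 * (q K * a\<^sup>2) + 2 * (q K * (\<Sum>i<K. c i * e i)\<^sup>2)) \<longlonglongrightarrow> 2 * (0 * a\<^sup>2) + 2 * 0"
    by (intro tendsto_intros tendsto_tail_weighted_square tail_sequencesD(5)[OF q] assms)
  have "(\<lambda>K. q K * (B K)\<^sup>2) \<longlonglongrightarrow> 0"
  proof (rule tendsto_sandwich[OF always_eventually always_eventually tendsto_const])
    show "(\<lambda>K. 2 * (q K * a\<^sup>2) + 2 * (q K * (\<Sum>i<K. c i * e i)\<^sup>2)) \<longlonglongrightarrow> 0"
      using lim by simp
    show "\<forall>K. 0 \<le> q K * (B K)\<^sup>2"
      using tail_sequencesD(2)[OF q] by (simp add: less_imp_le)
    show "\<forall>K. q K * (B K)\<^sup>2 \<le> 2 * (q K * a\<^sup>2) + 2 * (q K * (\<Sum>i<K. c i * e i)\<^sup>2)"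
    proof
      fix K
      have "(B K)\<^sup>2 \<le> 2 * a\<^sup>2 + 2 * (\<Sum>i<K. c i * e i)\<^sup>2"
        using sum_squares_bound[of a "- (\<Sum>i<K. c i * e i)"] by (simp add: B_def power2_diff)
      then have "q K * (B K)\<^sup>2 \<le> q K * (2 * a\<^sup>2 + 2 * (\<Sum>i<K. c i * e i)\<^sup>2)"
        using tail_sequencesD(2)[OF q, of K] by (simp add: mult_left_mono)
      then show "q K * (B K)\<^sup>2 \<le> 2 * (q K * a\<^sup>2) + 2 * (q K * (\<Sum>i<K. c i * e i)\<^sup>2)"
        by (simp add: algebra_simps)
    qed
  qed
  from tendsto_add[OF tendsto_diff[OF tendsto_const[of "a\<^sup>2"] this] summable_LIMSEQ[OF assms]]
  show ?thesis by (simp add: sums_def sum_pm_square)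
qed

text \<open>Since \<open>q K * B K\<close> tends to \<open>0\<close>, \<open>q n * B n\<close> is the tail \<open>\<Sum>i\<ge>n. (q i - q (Suc i)) * m i\<close>, and
  Cauchy--Schwarz bounds \<open>q n * (B n)\<^sup>2\<close>.\<close>
lemma summable_of_tail_mean_square:
  assumes sm: "summable (\<lambda>n. (q n - q (Suc n)) * (m n)\<^sup>2)"
  shows "summable (\<lambda>i. c i * (e i)\<^sup>2)"
proof -
  define p where "p i = q i - q (Suc i)" for i
  define W where "W = (\<Sum>n. p n * (m n)\<^sup>2)"
  have p: "p i \<ge> 0" for i
    using tail_sequencesD(3)[OF q] by (simp add: p_def)
  have W: "(\<Sum>i\<in>I. p i * (m i)\<^sup>2) \<le> W" if "finite I" for I
    unfolding W_def by (intro sum_le_suminf sm[folded p_def] that mult_nonneg_nonneg p) auto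
  have bound: "q n * (B n)\<^sup>2 \<le> W" for n
  proof -
    have "(q n * B n - q K * B K)\<^sup>2 \<le> q n * W" if "K \<ge> n" for K
    proof -
      have "q n * B n - q K * B K = (\<Sum>i\<in>{n..<K}. p i * m i)"
        using sum_pm[of n] sum_pm[of K] that
          sum.atLeastLessThan_concat[of 0 n K "\<lambda>i. p i * m i"]
        by (simp add: p_def lessThan_atLeast0)
      also have "\<dots> = (\<Sum>i\<in>{n..<K}. sqrt (p i) * (sqrt (p i) * m i))"
        using p by (simp flip: mult.assoc)
      also have "\<dots>\<^sup>2 \<le> (\<Sum>i\<in>{n..<K}. (sqrt (p i))\<^sup>2) * (\<Sum>i\<in>{n..<K}. (sqrt (p i) * m i)\<^sup>2)"
        by (rule Cauchy_Schwarz_ineq_sum)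
      also have "\<dots> = (\<Sum>i\<in>{n..<K}. p i) * (\<Sum>i\<in>{n..<K}. p i * (m i)\<^sup>2)"
        using p by (simp add: power_mult_distrib)
      also have "(\<Sum>i\<in>{n..<K}. p i) = q n - q K"
        using sum_Suc_diff'[OF that, of "\<lambda>i. - q i"] by (simp add: p_def)
      also have "(q n - q K) * (\<Sum>i\<in>{n..<K}. p i * (m i)\<^sup>2) \<le> q n * W"
        using tail_sequencesD(2)[OF q, of n] tail_sequencesD(2)[OF q, of K] p
        by (intro mult_mono W sum_nonneg) auto
      finally show ?thesis .
    qed
    \<comment> \<open>The bound \<open>q n * W\<close> is free of \<open>K\<close>, so the term
      \<open>q K * B K\<close> can be sent to 0; one factor \<open>q n\<close> then cancels.\<close>
    then have "\<forall>\<^sub>F K in sequentially. (q n * B n - q K * B K)\<^sup>2 \<le> q n * W"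
      by (auto simp: eventually_sequentially)
    moreover have "(\<lambda>K. (q n * B n - q K * B K)\<^sup>2) \<longlonglongrightarrow> (q n * B n - 0)\<^sup>2"
      by (intro tendsto_intros tendsto_qB)
    ultimately have "(q n * B n)\<^sup>2 \<le> q n * W"
      using tendsto_upperbound by fastforce
    then show ?thesis
      using tail_sequencesD(2)[OF q, of n] by (simp add: power2_eq_square mult_ac)
  qed
  show ?thesis
  proof (rule summableI_nonneg_bounded)
    show "0 \<le> c n * (e n)\<^sup>2" for n
      using inverse_tail_diff_nonneg by simp
    \<comment> \<open>In \<open>sum_pm_square\<close> one \<open>W\<close> bounds the sum of the
      weighted squares of \<open>m\<close>, the other bounds \<open>q K * (B K)^2\<close>, and the
      square of \<open>a\<close> is dropped.\<close>
    show "(\<Sum>i<K. c i * (e i)\<^sup>2) \<le> 2 * W" for K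
      using sum_pm_square[of K] W[OF finite_lessThan, of K] bound[of K]
        zero_le_power2[of a] unfolding p_def by linarith
  qed
qed

end

text \<open>A Tonelli exchange. Cut off at \<open>K\<close>, the left series gives
  \<open>u i\<close> the weight \<open>q i - q K\<close> instead of \<open>q i\<close>; the two
  series are therefore compared through bounds on their partial sums. The form with
  \<open>sums\<close> carries over both convergence and value.\<close>

lemma sums_tail_partial_sums_iff:
  fixes u :: "nat \<Rightarrow> real"
  assumes u: "\<And>n. u n \<ge> 0"
  shows "(\<lambda>n. (q n - q (Suc n)) * (\<Sum>i\<le>n. u i)) sums s \<longleftrightarrow> (\<lambda>n. q n * u n) sums s"
proof -
  have part: "(\<Sum>n<K. (q n - q (Suc n)) * (\<Sum>i\<le>n. u i)) = (\<Sum>i<K. (q i - q K) * u i)" for K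
  proof (induction K)
    case (Suc K)
    have "(\<Sum>i<Suc K. (q i - q (Suc K)) * u i) =
        (\<Sum>i<K. (q i - q K) * u i) + (q K - q (Suc K)) * (\<Sum>i\<le>K. u i)"
      by (simp add: lessThan_Suc_atMost[symmetric] algebra_simps sum.distrib sum_subtractf
          sum_distrib_left)
    then show ?case using Suc by simp
  qed simp
  have l0: "0 \<le> (q n - q (Suc n)) * (\<Sum>i\<le>n. u i)" for n
    using tail_sequencesD(3)[OF q] u by (simp add: sum_nonneg)
  have r0: "0 \<le> q n * u n" for n
    using tail_sequencesD(2)[OF q] u by (simp add: less_imp_le)
  have le: "(\<Sum>n<J. q n * u n) \<le> t" if t: "(\<lambda>n. (q n - q (Suc n)) * (\<Sum>i\<le>n. u i)) sums t" for J t
  proof (rule tendsto_upperbound)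
    \<comment> \<open>Only finitely many terms are kept while \<open>K\<close> grows, so the missing
      \<open>q K\<close> disappears term by term.\<close>
    have "(\<lambda>K. \<Sum>i<J. (q i - q K) * u i) \<longlonglongrightarrow> (\<Sum>i<J. (q i - 0) * u i)"
      by (intro tendsto_intros tail_sequencesD(5)[OF q])
    then show "(\<lambda>K. \<Sum>i<J. (q i - q K) * u i) \<longlonglongrightarrow> (\<Sum>i<J. q i * u i)" by simp
    have "(\<Sum>i<J. (q i - q K) * u i) \<le> t" if "K \<ge> J" for K
    proof -
      have "(\<Sum>i<J. (q i - q K) * u i) \<le> (\<Sum>i<K. (q i - q K) * u i)"
        using that u decseqD[OF tail_sequencesD(4)[OF q]] by (intro sum_mono2) auto
      also have "\<dots> \<le> t"
        unfolding part[symmetric] sums_unique[OF t]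
        by (intro sum_le_suminf sums_summable[OF t] l0) auto
      finally show ?thesis .
    qed
    then show "\<forall>\<^sub>F K in sequentially. (\<Sum>i<J. (q i - q K) * u i) \<le> t"
      by (auto simp: eventually_sequentially)
  qed simp
  have ge: "(\<Sum>n<J. (q n - q (Suc n)) * (\<Sum>i\<le>n. u i)) \<le> t" if t: "(\<lambda>n. q n * u n) sums t" for J t
  proof -
    have "(\<Sum>i<J. (q i - q J) * u i) \<le> (\<Sum>i<J. q i * u i)"
      using u tail_sequencesD(2)[OF q, of J] by (intro sum_mono mult_right_mono) auto
    also have "\<dots> \<le> t"
      unfolding sums_unique[OF t] by (intro sum_le_suminf sums_summable[OF t] r0) auto
    finally show ?thesis by (simp add: part)
  qed
  show ?thesis
  proof
    assume s: "(\<lambda>n. (q n - q (Suc n)) * (\<Sum>i\<le>n. u i)) sums s"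
    have sm: "summable (\<lambda>n. q n * u n)"
      using summableI_nonneg_bounded[OF r0 le[OF s]] .
    have "s \<le> (\<Sum>n. q n * u n)"
      unfolding sums_unique[OF s]
      by (rule suminf_le_const[OF sums_summable[OF s] ge[OF summable_sums[OF sm]]])
    moreover have "(\<Sum>n. q n * u n) \<le> s"
      by (rule suminf_le_const[OF sm le[OF s]])
    ultimately show "(\<lambda>n. q n * u n) sums s"
      using sm by (auto simp: sums_iff)
  next
    assume s: "(\<lambda>n. q n * u n) sums s"
    have sm: "summable (\<lambda>n. (q n - q (Suc n)) * (\<Sum>i\<le>n. u i))"
      using summableI_nonneg_bounded[OF l0 ge[OF s]] .
    have "s \<le> (\<Sum>n. (q n - q (Suc n)) * (\<Sum>i\<le>n. u i))"
      unfolding sums_unique[OF s]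
      by (rule suminf_le_const[OF sums_summable[OF s] le[OF summable_sums[OF sm]]])
    moreover have "(\<Sum>n. (q n - q (Suc n)) * (\<Sum>i\<le>n. u i)) \<le> s"
      by (rule suminf_le_const[OF sm ge[OF s]])
    ultimately show "(\<lambda>n. (q n - q (Suc n)) * (\<Sum>i\<le>n. u i)) sums s"
      using sm by (auto simp: sums_iff)
  qed
qed

end

subsection \<open>Independence and random indices\<close>

text \<open>Measurable images generate smaller sigma-algebras, so independence survives. With
  real-valued images this gives access to the product rule for expectations under
  \<open>indep_var\<close>.\<close>

lemma (in prob_space) indep_rvs_compose:
  assumes "indep_rvs M S X T Z" "f \<in> measurable S S'" "g \<in> measurable T T'"
  shows "indep_var S' (\<lambda>\<omega>. f (X \<omega>)) T' (\<lambda>\<omega>. g (Z \<omega>))"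
proof -
  have X: "X \<in> measurable M S" and Z: "Z \<in> measurable M T"
    and ind: "indep_set {X -` A \<inter> space M | A. A \<in> sets S} {Z -` B \<inter> space M | B. B \<in> sets T}"
    using assms(1) by (auto simp: indep_rvs_def)
  have sub: "{(\<lambda>\<omega>. h (V \<omega>)) -` A \<inter> space M | A. A \<in> sets R'} \<subseteq> {V -` A \<inter> space M | A. A \<in> sets R}"
    if "V \<in> measurable M R" "h \<in> measurable R R'" for V :: "'a \<Rightarrow> 'e" and h :: "'e \<Rightarrow> 'f" and R R'
  proof safe
    fix A assume "A \<in> sets R'"
    then have "h -` A \<inter> space R \<in> sets R"
      using that(2) by (rule measurable_sets[rotated])
    moreover have "(\<lambda>\<omega>. h (V \<omega>)) -` A \<inter> space M = V -` (h -` A \<inter> space R) \<inter> space M"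
      using measurable_space[OF that(1)] by auto
    ultimately show "\<exists>B. (\<lambda>\<omega>. h (V \<omega>)) -` A \<inter> space M = V -` B \<inter> space M \<and> B \<in> sets R"
      by blast
  qed
  have "indep_set {(\<lambda>\<omega>. f (X \<omega>)) -` A \<inter> space M | A. A \<in> sets S'}
      {(\<lambda>\<omega>. g (Z \<omega>)) -` A \<inter> space M | A. A \<in> sets T'}"
    unfolding indep_set_def
    using sub[OF X assms(2)] sub[OF Z assms(3)]
    by (intro indep_sets_mono_sets[OF ind[unfolded indep_set_def]]) (simp split: bool.split)
  then have "indep_sets (\<lambda>i. {case_bool (\<lambda>\<omega>. f (X \<omega>)) (\<lambda>\<omega>. g (Z \<omega>)) i -` A \<inter> space M | A.
      A \<in> sets (case_bool S' T' i)}) UNIV"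
    unfolding indep_set_def by (rule indep_sets_mono_sets) (simp split: bool.split)
  moreover have "(\<lambda>\<omega>. f (X \<omega>)) \<in> measurable M S'" "(\<lambda>\<omega>. g (Z \<omega>)) \<in> measurable M T'"
    using X Z assms(2,3) by measurable
  ultimately show ?thesis
    unfolding indep_var_def indep_vars_def2 UNIV_bool by simp
qed

text \<open>Induction on \<open>I\<close>: the new variable is independent of the sum of the others,
  so the expectation of their product factorises and cancels against the cross term of the squared
  mean. Square integrability goes through the same induction because the variance formula needs it
  at each stage.\<close>

lemma (in prob_space) variance_sum_indep_vars:
  fixes X :: "'i \<Rightarrow> 'a \<Rightarrow> real"
  assumes "finite I" "indep_vars (\<lambda>_. borel) X I" "\<And>i. i \<in> I \<Longrightarrow> integrable M (\<lambda>\<omega>. (X i \<omega>)\<^sup>2)"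
  shows "integrable M (\<lambda>\<omega>. (\<Sum>i\<in>I. X i \<omega>)\<^sup>2)"
    and "variance (\<lambda>\<omega>. \<Sum>i\<in>I. X i \<omega>) = (\<Sum>i\<in>I. variance (X i))"
proof -
  have "integrable M (\<lambda>\<omega>. (\<Sum>i\<in>I. X i \<omega>)\<^sup>2) \<and>
      variance (\<lambda>\<omega>. \<Sum>i\<in>I. X i \<omega>) = (\<Sum>i\<in>I. variance (X i))"
    using assms
  proof (induction I rule: finite_induct)
    case (insert x F)
    define S where "S = (\<lambda>\<omega>. \<Sum>i\<in>F. X i \<omega>)"
    have S2: "integrable M (\<lambda>\<omega>. (S \<omega>)\<^sup>2)" and varS: "variance S = (\<Sum>i\<in>F. variance (X i))"
      using insert.IH indep_vars_subset[OF insert.prems(1), of F] insert.prems(2)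
      by (auto simp: S_def)
    have ind: "indep_var borel (X x) borel S"
      unfolding S_def using insert by (intro indep_vars_sum) auto
    note [measurable] = indep_var_rv1[OF ind] indep_var_rv2[OF ind]
    have X2: "integrable M (\<lambda>\<omega>. (X x \<omega>)\<^sup>2)" using insert.prems(2) by simp
    have X1: "integrable M (X x)" and S1: "integrable M S"
      using X2 S2 by (auto intro: square_integrable_imp_integrable)
    define V where "V \<omega> = X x \<omega> * S \<omega>" for \<omega>
    have V: "integrable M V" "expectation V = expectation (X x) * expectation S"
      using indep_var_integrable[OF ind X1 S1] indep_var_lebesgue_integral[OF ind X1 S1]
      by (auto simp: V_def [abs_def])
    have sq: "(\<lambda>\<omega>. (X x \<omega> + S \<omega>)\<^sup>2) = (\<lambda>\<omega>. (X x \<omega>)\<^sup>2 + (S \<omega>)\<^sup>2 + 2 * V \<omega>)"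
      by (simp add: fun_eq_iff power2_sum V_def)
    have int: "integrable M (\<lambda>\<omega>. (X x \<omega> + S \<omega>)\<^sup>2)"
      unfolding sq using X2 S2 V(1) by simp
    have "expectation (\<lambda>\<omega>. (X x \<omega> + S \<omega>)\<^sup>2) =
        expectation (\<lambda>\<omega>. (X x \<omega>)\<^sup>2) + expectation (\<lambda>\<omega>. (S \<omega>)\<^sup>2) + 2 * expectation V"
      unfolding sq using X2 S2 V(1) by simp
    then have "variance (\<lambda>\<omega>. X x \<omega> + S \<omega>) = variance (X x) + variance S"
      using variance_eq[of "\<lambda>\<omega>. X x \<omega> + S \<omega>"] variance_eq[of "X x"] variance_eq[of S]
        X1 S1 X2 S2 V int by (simp add: power2_sum)
    then show ?case
      using insert int varS by (simp add: S_def)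
  qed (simp add: prob_space)
  then show "integrable M (\<lambda>\<omega>. (\<Sum>i\<in>I. X i \<omega>)\<^sup>2)"
    and "variance (\<lambda>\<omega>. \<Sum>i\<in>I. X i \<omega>) = (\<Sum>i\<in>I. variance (X i))"
    by auto
qed

section \<open>Slicing an integral along the values of \<open>N\<close>\<close>

lemma sum_indicator_singleton:
  fixes z :: real and N K :: nat
  shows "(\<Sum>n<K. indicator {n} N * z) = (if N < K then z else 0)"
proof -
  have "(\<Sum>n<K. indicator {n} N * z) = (\<Sum>n<K. if N = n then z else 0)"
    by (intro sum.cong) auto
  also have "\<dots> = (if N < K then z else 0)"
    by simp
  finally show ?thesis .
qed

lemma tendsto_if_less_const:
  fixes z :: real and N :: nat
  shows "(\<lambda>K. if N < K then z else 0) \<longlonglongrightarrow> z"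
  by (intro tendsto_eventually eventually_sequentiallyI[of "Suc N"]) auto

text \<open>The first \<open>K\<close> slices add up to \<open>Z\<close> truncated to
  \<open>N < K\<close>; dominated convergence with bound \<open>\<bar>Z\<bar>\<close>
  applies.\<close>

lemma sums_integral_indicator:
  fixes Z :: "'a \<Rightarrow> real" and N :: "'a \<Rightarrow> nat"
  assumes [measurable]: "N \<in> measurable M (count_space UNIV)" and Z: "integrable M Z"
  shows "(\<lambda>n. \<integral>\<omega>. indicator {n} (N \<omega>) * Z \<omega> \<partial>M) sums (\<integral>\<omega>. Z \<omega> \<partial>M)"
proof -
  note [measurable] = borel_measurable_integrable[OF Z]
  have int: "integrable M (\<lambda>\<omega>. indicator {n} (N \<omega>) * Z \<omega>)" for n
    by (rule Bochner_Integration.integrable_bound[OF Z]) (auto simp: indicator_def)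
  have "(\<lambda>K. \<integral>\<omega>. (if N \<omega> < K then Z \<omega> else 0) \<partial>M) \<longlonglongrightarrow> (\<integral>\<omega>. Z \<omega> \<partial>M)"
  proof (rule integral_dominated_convergence)
    show "integrable M (\<lambda>\<omega>. \<bar>Z \<omega>\<bar>)" using Z by simp
    show "AE \<omega> in M. (\<lambda>K. if N \<omega> < K then Z \<omega> else 0) \<longlonglongrightarrow> Z \<omega>"
      by (intro AE_I2 tendsto_if_less_const)
  qed auto
  moreover have "(\<Sum>n<K. \<integral>\<omega>. indicator {n} (N \<omega>) * Z \<omega> \<partial>M) =
      (\<integral>\<omega>. (if N \<omega> < K then Z \<omega> else 0) \<partial>M)" for K
    unfolding sum_indicator_singleton[symmetric]
    by (rule Bochner_Integration.integral_sum[symmetric]) (rule int)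
  ultimately show ?thesis
    by (simp add: sums_def)
qed

text \<open>A converse in which integrability is concluded: for nonnegative \<open>Z\<close> the
  truncations to \<open>N < K\<close> increase, and monotone convergence applies.\<close>

lemma integrable_of_sums_integral_indicator:
  fixes Z :: "'a \<Rightarrow> real" and N :: "'a \<Rightarrow> nat"
  assumes [measurable]: "N \<in> measurable M (count_space UNIV)" "Z \<in> borel_measurable M"
    and nonneg: "\<And>\<omega>. 0 \<le> Z \<omega>"
    and int: "\<And>n. integrable M (\<lambda>\<omega>. indicator {n} (N \<omega>) * Z \<omega>)"
    and s: "(\<lambda>n. \<integral>\<omega>. indicator {n} (N \<omega>) * Z \<omega> \<partial>M) sums s"
  shows "integrable M Z"
proof (rule integral_monotone_convergence_nonneg(1))
  show "integrable M (\<lambda>\<omega>. if N \<omega> < K then Z \<omega> else 0)" for K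
    unfolding sum_indicator_singleton[symmetric] by (intro Bochner_Integration.integrable_sum int)
  show "(\<lambda>K. \<integral>\<omega>. (if N \<omega> < K then Z \<omega> else 0) \<partial>M) \<longlonglongrightarrow> s"
    unfolding sum_indicator_singleton[symmetric] Bochner_Integration.integral_sum[OF int]
    using s by (simp add: sums_def)
  show "AE \<omega> in M. (\<lambda>K. if N \<omega> < K then Z \<omega> else 0) \<longlonglongrightarrow> Z \<omega>"
    by (intro AE_I2 tendsto_if_less_const)
qed (auto simp: nonneg mono_def)

context prob_space
begin

section \<open>Expectations at an independent random index\<close>

context
  fixes N :: "'a \<Rightarrow> nat" and W :: "'a \<Rightarrow> 'c" and T :: "'c measure" and g :: "nat \<Rightarrow> 'c \<Rightarrow> real"
  assumes ind: "indep_rvs M (count_space UNIV) N T W"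
    and g [measurable]: "\<And>n. g n \<in> borel_measurable T"
    and int: "\<And>n. integrable M (\<lambda>\<omega>. g n (W \<omega>))"
begin

private lemma N_W_measurable:
  "N \<in> measurable M (count_space UNIV)" "W \<in> measurable M T"
  using ind by (auto simp: indep_rvs_def)

lemma random_index_measurable: "(\<lambda>\<omega>. g (N \<omega>) (W \<omega>)) \<in> borel_measurable M"
proof -
  note [measurable] = N_W_measurable
  show ?thesis
    by (rule measurable_compose_countable[of "\<lambda>n \<omega>. g n (W \<omega>)"]) measurable
qed

text \<open>On the event that \<open>N\<close> equals \<open>n\<close> the index can be frozen to
  \<open>n\<close>; the indicator is then independent of \<open>g n (W \<omega>)\<close>.\<close>

private lemma slice:
  "integrable M (\<lambda>\<omega>. indicator {n} (N \<omega>) * g (N \<omega>) (W \<omega>))"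
  "expectation (\<lambda>\<omega>. indicator {n} (N \<omega>) * g (N \<omega>) (W \<omega>)) =
    prob {\<omega> \<in> space M. N \<omega> = n} * expectation (\<lambda>\<omega>. g n (W \<omega>))"
proof -
  note [measurable] = N_W_measurable
  have eq: "(\<lambda>\<omega>. indicator {n} (N \<omega>) * g (N \<omega>) (W \<omega>)) =
      (\<lambda>\<omega>. indicator {n} (N \<omega>) * g n (W \<omega>) :: real)"
    by (auto simp: indicator_def)
  have iv: "indep_var borel (\<lambda>\<omega>. indicator {n} (N \<omega>) :: real) borel (\<lambda>\<omega>. g n (W \<omega>))"
    by (rule indep_rvs_compose[OF ind]) auto
  have i: "integrable M (\<lambda>\<omega>. indicator {n} (N \<omega>) :: real)"
    by (rule integrable_const_bound[of _ 1]) (auto simp: indicator_def)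
  have "expectation (\<lambda>\<omega>. indicat_real {n} (N \<omega>)) =
      expectation (indicat_real {\<omega> \<in> space M. N \<omega> = n})"
    by (rule Bochner_Integration.integral_cong) (auto simp: indicator_def)
  then have "expectation (\<lambda>\<omega>. indicat_real {n} (N \<omega>)) = prob {\<omega> \<in> space M. N \<omega> = n}"
    by simp
  then show "integrable M (\<lambda>\<omega>. indicator {n} (N \<omega>) * g (N \<omega>) (W \<omega>))"
    "expectation (\<lambda>\<omega>. indicator {n} (N \<omega>) * g (N \<omega>) (W \<omega>)) =
      prob {\<omega> \<in> space M. N \<omega> = n} * expectation (\<lambda>\<omega>. g n (W \<omega>))"
    unfolding eq using indep_var_integrable[OF iv i int] indep_var_lebesgue_integral[OF iv i int]
    by auto
qed

lemma expectation_random_index_sums: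
  assumes "integrable M (\<lambda>\<omega>. g (N \<omega>) (W \<omega>))"
  shows "(\<lambda>n. prob {\<omega> \<in> space M. N \<omega> = n} * expectation (\<lambda>\<omega>. g n (W \<omega>))) sums
    expectation (\<lambda>\<omega>. g (N \<omega>) (W \<omega>))"
  using sums_integral_indicator[OF N_W_measurable(1) assms] by (simp add: slice(2))

lemma integrable_random_index_iff:
  assumes "\<And>n x. 0 \<le> g n x"
  shows "integrable M (\<lambda>\<omega>. g (N \<omega>) (W \<omega>)) \<longleftrightarrow>
    summable (\<lambda>n. prob {\<omega> \<in> space M. N \<omega> = n} * expectation (\<lambda>\<omega>. g n (W \<omega>)))"
proof
  assume "summable (\<lambda>n. prob {\<omega> \<in> space M. N \<omega> = n} * expectation (\<lambda>\<omega>. g n (W \<omega>)))"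
  then show "integrable M (\<lambda>\<omega>. g (N \<omega>) (W \<omega>))"
    by (intro integrable_of_sums_integral_indicator[OF N_W_measurable(1) random_index_measurable])
      (auto simp: assms slice)
qed (use expectation_random_index_sums sums_summable in blast)

end

section \<open>Square-integrable random variables\<close>

lemma L2_norm_sq: "(L2_norm M X)\<^sup>2 = expectation (\<lambda>\<omega>. (X \<omega>)\<^sup>2)"
  by (simp add: L2_norm_def)

lemma square_integrable_diff:
  assumes "square_integrable M X" "square_integrable M Z"
  shows "square_integrable M (\<lambda>\<omega>. X \<omega> - Z \<omega>)"
proof -
  have [measurable]: "X \<in> borel_measurable M" "Z \<in> borel_measurable M"
    and "integrable M (\<lambda>\<omega>. (X \<omega>)\<^sup>2)" "integrable M (\<lambda>\<omega>. (Z \<omega>)\<^sup>2)"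
    using assms by (simp_all add: square_integrable_def)
  then have int: "integrable M (\<lambda>\<omega>. 2 * (X \<omega>)\<^sup>2 + 2 * (Z \<omega>)\<^sup>2)"
    by (intro Bochner_Integration.integrable_add integrable_mult_right)
  have "(x - z)\<^sup>2 \<le> 2 * x\<^sup>2 + 2 * z\<^sup>2" for x z :: real
    using sum_squares_bound[of x "- z"] by (simp add: power2_diff)
  then have "AE \<omega> in M. norm ((X \<omega> - Z \<omega>)\<^sup>2) \<le> norm (2 * (X \<omega>)\<^sup>2 + 2 * (Z \<omega>)\<^sup>2)"
    by simp
  then have "integrable M (\<lambda>\<omega>. (X \<omega> - Z \<omega>)\<^sup>2)"
    by (intro Bochner_Integration.integrable_bound[OF int]) measurable
  then show ?thesis
    by (simp add: square_integrable_def)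
qed

lemma square_integrableD:
  assumes "square_integrable M X"
  shows "X \<in> borel_measurable M" "integrable M X" "integrable M (\<lambda>\<omega>. (X \<omega>)\<^sup>2)"
  using assms by (auto simp: square_integrable_def intro: square_integrable_imp_integrable)

text \<open>This is nonnegativity of the variance. It turns convergence in the norm into convergence
  of the means.\<close>

lemma abs_expectation_le_L2_norm:
  assumes "square_integrable M X"
  shows "\<bar>expectation X\<bar> \<le> L2_norm M X"
proof -
  have "(expectation X)\<^sup>2 \<le> expectation (\<lambda>\<omega>. (X \<omega>)\<^sup>2)"
    using variance_positive[of X] variance_eq[of X] square_integrableD[OF assms] by simp
  then show ?thesis
    unfolding L2_norm_def by (rule real_le_rsqrt[of "\<bar>expectation X\<bar>", simplified])
qed

end

subsection \<open>The independent sum estimator\<close>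

text \<open>The copies \<open>D n\<close> and the index \<open>N\<close> may live on a space
  \<open>P\<close> other than \<open>M\<close>; the two spaces are linked only through equality of
  laws.\<close>

theorem theorem2p2:
  fixes M :: "'a measure" and P :: "'b measure"
    and Y :: "'a \<Rightarrow> real" and Yn :: "nat \<Rightarrow> 'a \<Rightarrow> real"
    and D :: "nat \<Rightarrow> 'b \<Rightarrow> real" and N :: "'b \<Rightarrow> nat" and q :: "nat \<Rightarrow> real"
    and Z :: "'b \<Rightarrow> real"
  assumes "prob_space M" and "prob_space P"
    and "square_integrable M Y" and "\<And>n. square_integrable M (Yn n)"
    and "(\<lambda>n. L2_norm M (\<lambda>\<omega>. Yn n \<omega> - Y \<omega>)) \<longlonglongrightarrow> 0"
    and "prob_space.indep_vars P (\<lambda>_. borel) D UNIV"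
    and "\<And>n. distr P borel (D n) = distr M borel (increment Yn n)"
    and "q \<in> tail_sequences"
    and "N \<in> measurable P (count_space UNIV)"
    and "indep_rvs P (count_space UNIV) N (\<Pi>\<^sub>M i\<in>UNIV. borel) (\<lambda>\<omega> i. D i \<omega>)"
    and "\<And>i. prob_space.prob P {\<omega> \<in> space P. N \<omega> \<ge> i} = q i"
    and "Z = independent_sum_estimator q D N"
  shows "(square_integrable P Z \<longleftrightarrow> summable (variance_series_term M Yn Y q)) \<and>
    (summable (variance_series_term M Yn Y q) \<longrightarrow>
       prob_space.expectation P Z = prob_space.expectation M Y \<and>
       (L2_norm P Z)\<^sup>2 =
         (prob_space.expectation M Y)\<^sup>2 + (\<Sum>i. variance_series_term M Yn Y q i))"
proof -
  interpret M: prob_space M by fact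
  interpret P: prob_space P by fact
  note q = \<open>q \<in> tail_sequences\<close>
  note q0 = tail_sequencesD(1)[OF q] and q_pos = tail_sequencesD(2)[OF q]
  define a where "a = M.expectation Y"
  define e where "e n = M.expectation (\<lambda>\<omega>. Yn n \<omega> - Y \<omega>)" for n
  define v where "v n = M.variance (increment Yn n)" for n
  define c where "c n = 1 / q (Suc n) - 1 / q n" for n
  define p where "p n = q n - q (Suc n)" for n
  define g where "g n d = (\<Sum>i=0..n. d i / q i)" for n and d :: "nat \<Rightarrow> real"
  define m where "m n = P.expectation (\<lambda>\<omega>. g n (\<lambda>i. D i \<omega>))" for n
  define U where "U n = (\<Sum>i\<le>n. v i / (q i)\<^sup>2)" for n

  note Y = M.square_integrableD[OF assms(3)] and Yn = M.square_integrableD[OF assms(4)]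
  have c_nonneg: "c n \<ge> 0" for n
    unfolding c_def by (rule inverse_tail_diff_nonneg[OF q])
  have v_nonneg: "v n \<ge> 0" for n
    unfolding v_def by simp
  have e_lim: "e \<longlonglongrightarrow> 0"
  proof (rule Lim_null_comparison[OF always_eventually assms(5)])
    show "\<forall>n. norm (e n) \<le> L2_norm M (\<lambda>\<omega>. Yn n \<omega> - Y \<omega>)"
      using M.abs_expectation_le_L2_norm[OF M.square_integrable_diff[OF assms(4,3)]]
      by (simp add: e_def)
  qed

  have incr: "square_integrable M (increment Yn n)" for n
    using assms(4) M.square_integrable_diff[OF assms(4) assms(4)]
    by (cases n) (simp_all add: increment_def)
  note incr = incr M.square_integrableD[OF incr]
  \<comment> \<open>The mean of \<open>Y\<close> cancels in every increment except the first, where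
    nothing is subtracted.\<close>
  have incr_mean: "M.expectation (increment Yn 0) = e 0 + a"
    "M.expectation (increment Yn (Suc n)) = e (Suc n) - e n" for n
    using Y Yn by (simp_all add: increment_def e_def a_def)

  \<comment> \<open>Moments of the partial sums, transported from \<open>M\<close> to
    \<open>P\<close> by equality of laws\<close>
  have D_meas [measurable]: "D n \<in> borel_measurable P" for n
    using assms(6) by (simp add: P.indep_vars_def)
  have D_integral: "P.expectation (\<lambda>\<omega>. f (D n \<omega>)) = M.expectation (\<lambda>\<omega>. f (increment Yn n \<omega>))"
    and D_integrable: "integrable P (\<lambda>\<omega>. f (D n \<omega>)) \<longleftrightarrow> integrable M (\<lambda>\<omega>. f (increment Yn n \<omega>))"
    if [measurable]: "f \<in> borel_measurable borel" for f :: "real \<Rightarrow> real" and n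
    using integral_distr[OF D_meas that, of n] integral_distr[OF incr(2) that, of n]
      integrable_distr_eq[OF D_meas that, of n] integrable_distr_eq[OF incr(2) that, of n] assms(7)[of n]
    by simp_all
  have D_mean: "P.expectation (D n) = M.expectation (increment Yn n)" for n
    using D_integral[of "\<lambda>x. x" n] by simp
  have D_int: "integrable P (D n)" for n
    using D_integrable[of "\<lambda>x. x" n] incr by simp

  have g_meas: "g n \<in> borel_measurable (\<Pi>\<^sub>M i\<in>UNIV. borel)" for n
    unfolding g_def by measurable
  have g_int: "integrable P (\<lambda>\<omega>. g n (\<lambda>i. D i \<omega>))" for n
    unfolding g_def by (intro Bochner_Integration.integrable_sum integrable_divide_zero D_int)
  have m_eq: "m n = e n / q n + (a - (\<Sum>i<n. c i * e i))" for n
  proof -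
    have "m n = (\<Sum>i\<le>n. M.expectation (increment Yn i) / q i)"
      using D_int by (simp add: m_def g_def D_mean atLeast0AtMost)
    also have "\<dots> = (e 0 + a) / q 0 + (\<Sum>i<n. (e (Suc i) - e i) / q (Suc i))"
      by (simp add: sum.atMost_shift incr_mean)
    also have "\<dots> = e n / q n + (a / q 0 - (\<Sum>i<n. c i * e i))"
      unfolding c_def using q_pos by (intro sum_increment_div) (simp add: less_imp_neq[symmetric])
    finally show ?thesis by (simp add: q0)
  qed
  have indep: "P.indep_vars (\<lambda>_. borel) (\<lambda>i \<omega>. D i \<omega> / q i) {0..n}" for n
    by (rule P.indep_vars_compose2[OF P.indep_vars_subset[OF assms(6)]]) auto
  have sq_int: "integrable P (\<lambda>\<omega>. (D i \<omega> / q i)\<^sup>2)" for i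
    using D_integrable[of "\<lambda>x. x\<^sup>2" i] incr by (simp add: power_divide)
  have var: "P.variance (\<lambda>\<omega>. D i \<omega> / q i) = v i / (q i)\<^sup>2" for i
  proof -
    have "P.variance (\<lambda>\<omega>. D i \<omega> / q i) = P.expectation (\<lambda>\<omega>. (D i \<omega> - P.expectation (D i))\<^sup>2 / (q i)\<^sup>2)"
      by (simp add: power_divide flip: diff_divide_distrib)
    also have "\<dots> = v i / (q i)\<^sup>2"
      using D_integral[of "\<lambda>x. (x - P.expectation (D i))\<^sup>2" i] by (simp add: v_def D_mean)
    finally show ?thesis .
  qed
  have g2_int: "integrable P (\<lambda>\<omega>. (g n (\<lambda>i. D i \<omega>))\<^sup>2)" for n
    unfolding g_def using indep sq_int by (intro P.variance_sum_indep_vars(1)) auto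
  have g2: "P.expectation (\<lambda>\<omega>. (g n (\<lambda>i. D i \<omega>))\<^sup>2) = U n + (m n)\<^sup>2" for n
  proof -
    have "P.variance (\<lambda>\<omega>. g n (\<lambda>i. D i \<omega>)) = U n"
      using P.variance_sum_indep_vars(2)[OF finite_atLeastAtMost indep sq_int, of n, unfolded var]
      by (simp add: g_def U_def atLeast0AtMost)
    then show ?thesis
      using P.variance_eq[OF g_int g2_int, of n] by (simp add: m_def)
  qed

  \<comment> \<open>Conditioning on \<open>N\<close>\<close>
  have p_eq: "P.prob {\<omega> \<in> space P. N \<omega> = n} = p n" for n
  proof -
    have [measurable]: "N \<in> measurable P (count_space UNIV)" by fact
    have "{\<omega> \<in> space P. N \<omega> = n} = {\<omega> \<in> space P. N \<omega> \<ge> n} - {\<omega> \<in> space P. N \<omega> \<ge> Suc n}"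
      by auto
    also have "P.prob \<dots> = p n"
      by (subst P.finite_measure_Diff) (auto simp: assms(11) p_def)
    finally show ?thesis .
  qed
  have Z: "Z = (\<lambda>\<omega>. g (N \<omega>) (\<lambda>i. D i \<omega>))"
    by (simp add: assms(12) independent_sum_estimator_def g_def)
  have g2_meas: "(\<lambda>d. (g n d)\<^sup>2) \<in> borel_measurable (\<Pi>\<^sub>M i\<in>UNIV. borel)" for n
    using g_meas by measurable
  have Z_meas: "Z \<in> borel_measurable P"
    unfolding Z
    by (rule P.random_index_measurable[where W = "\<lambda>\<omega> i. D i \<omega>" and g = g,
          OF assms(10) g_meas g_int])
  have sqint_iff: "square_integrable P Z \<longleftrightarrow> summable (\<lambda>n. p n * (U n + (m n)\<^sup>2))"
    using P.integrable_random_index_iff[where W = "\<lambda>\<omega> i. D i \<omega>" and g = "\<lambda>n d. (g n d)\<^sup>2",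
      OF assms(10) g2_meas g2_int] Z_meas
    by (simp add: square_integrable_def g2 p_eq) (simp add: Z)

  \<comment> \<open>Comparison with the variance series\<close>
  have term_eq: "variance_series_term M Yn Y q = (\<lambda>i. v i / q i + c i * (e i)\<^sup>2)"
    by (simp add: fun_eq_iff variance_series_term_def v_def c_def e_def)
  have p_nonneg: "p n \<ge> 0" for n
    using tail_sequencesD(3)[OF q] by (simp add: p_def)
  have U_sums: "(\<lambda>n. p n * U n) sums s \<longleftrightarrow> (\<lambda>i. v i / q i) sums s" for s
  proof -
    \<comment> \<open>Dividing \<open>D i\<close> by \<open>q i\<close> scales its variance by the
      inverse square; the exchange of summation restores one factor \<open>q i\<close>, the
      probability that index \<open>i\<close> is reached.\<close>
    have "q i * (v i / (q i)\<^sup>2) = v i / q i" for i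
      by (simp add: power2_eq_square)
    then show ?thesis
      unfolding p_def U_def
      using sums_tail_partial_sums_iff[OF q, of "\<lambda>i. v i / (q i)\<^sup>2"] v_nonneg by simp
  qed
  have m_sums: "(\<lambda>n. p n * (m n)\<^sup>2) sums (a\<^sup>2 + (\<Sum>i. c i * (e i)\<^sup>2))"
    if "summable (\<lambda>i. c i * (e i)\<^sup>2)"
    using tail_mean_square_sums[OF q e_lim, folded c_def, OF m_eq that] by (simp add: p_def)
  have main_sums: "(\<lambda>n. p n * (U n + (m n)\<^sup>2)) sums (a\<^sup>2 + (\<Sum>i. v i / q i + c i * (e i)\<^sup>2))"
    if s: "summable (\<lambda>i. v i / q i + c i * (e i)\<^sup>2)"
  proof -
    \<comment> \<open>Both parts of the summand are nonnegative, so each is dominated by the whole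
      series and can be summed separately.\<close>
    have sv: "summable (\<lambda>i. v i / q i)"
      by (rule summable_comparison_test'[OF s, of 0])
        (use v_nonneg q_pos c_nonneg in \<open>simp add: less_imp_le\<close>)
    have se: "summable (\<lambda>i. c i * (e i)\<^sup>2)"
      by (rule summable_comparison_test'[OF s, of 0])
        (use v_nonneg q_pos c_nonneg in \<open>simp add: less_imp_le\<close>)
    show ?thesis
      using sums_add[OF iffD2[OF U_sums summable_sums[OF sv]] m_sums[OF se]] suminf_add[OF sv se]
      by (simp add: distrib_left add_ac)
  qed
  have iff: "square_integrable P Z \<longleftrightarrow> summable (variance_series_term M Yn Y q)"
    unfolding sqint_iff term_eq
  proof
    assume s: "summable (\<lambda>n. p n * (U n + (m n)\<^sup>2))"
    have U_nonneg: "U n \<ge> 0" for n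
      unfolding U_def using v_nonneg by (intro sum_nonneg) simp
    \<comment> \<open>Again nonnegativity splits the series; the two pieces are then handled by the
      exchange of summation and by the converse bound for the means.\<close>
    have "summable (\<lambda>n. p n * U n)" "summable (\<lambda>n. p n * (m n)\<^sup>2)"
      by (rule summable_comparison_test'[OF s, of 0],
          use p_nonneg U_nonneg in \<open>simp add: mult_left_mono\<close>)+
    then show "summable (\<lambda>i. v i / q i + c i * (e i)\<^sup>2)"
      using U_sums summable_of_tail_mean_square[OF q e_lim, folded c_def, OF m_eq]
      by (intro summable_add) (auto simp: summable_def p_def)
  qed (use main_sums sums_summable in blast)
  have "P.expectation Z = a \<and> (L2_norm P Z)\<^sup>2 = a\<^sup>2 + (\<Sum>i. variance_series_term M Yn Y q i)"
    if s: "summable (variance_series_term M Yn Y q)"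
  proof
    have "square_integrable P Z" using s iff by simp
    note Z_int = P.square_integrableD[OF this]
    have "(\<lambda>n. p n * m n) sums P.expectation Z"
      using P.expectation_random_index_sums[where W = "\<lambda>\<omega> i. D i \<omega>" and g = g,
        OF assms(10) g_meas g_int Z_int(2)[unfolded Z]]
      by (simp add: p_eq m_def Z)
    moreover have "(\<lambda>n. p n * m n) sums a"
      using tail_mean_sums[OF q e_lim, folded c_def, OF m_eq] by (simp add: p_def)
    ultimately show "P.expectation Z = a"
      by (rule sums_unique2)
    have "(\<lambda>n. p n * (U n + (m n)\<^sup>2)) sums P.expectation (\<lambda>\<omega>. (Z \<omega>)\<^sup>2)"
      using P.expectation_random_index_sums[where W = "\<lambda>\<omega> i. D i \<omega>" and g = "\<lambda>n d. (g n d)\<^sup>2",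
        OF assms(10) g2_meas g2_int Z_int(3)[unfolded Z]]
      by (simp add: p_eq g2 Z)
    from sums_unique2[OF this main_sums] s
    show "(L2_norm P Z)\<^sup>2 = a\<^sup>2 + (\<Sum>i. variance_series_term M Yn Y q i)"
      by (simp add: P.L2_norm_sq term_eq)
  qed
  with iff show ?thesis
    by (simp add: a_def)
qed

end
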